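(* Let $a,b$ be real numbers with $0\le a<b$, let $\alpha>0$ and $\rho>0$ be real numbers, and let $x:[a,b]\to\mathbb{R}$ be a function of class $C^1$. For $N\in\mathbb{N}$ (with $N\geq 1$) and $k\in\{1,\ldots,N\}$ define $$A=A_N=\frac{\rho^{-\alpha}}{\Gamma(\alpha+1)}\left[1+\sum_{k=1}^N\frac{\Gamma(k-\alpha)}{\Gamma(-\alpha)\,k!}\right],\qquad B_k=\frac{\rho^{1-\alpha}\,\Gamma(k-\alpha)}{\Gamma(\alpha+1)\,\Gamma(-\alpha)\,(k-1)!},$$ and define $W_k:[a,b]\to\mathbb{R}$ by $$W_k(t)=\int_t^b \tau^{\rho-1}(b^\rho-\tau^\rho)^{k-1}x(\tau)\,d\tau.$$ For $t\in[a,b)$ define $E_N(t)$ by the identity $$I_{b-}^{\alpha,\rho}x(t)=A\,(b^\rho-t^\rho)^\alpha x(t)-\sum_{k=1}^N B_k\,(b^\rho-t^\rho)^{\alpha-k}W_k(t)+E_N(t).$$ Then for every $t\in[a,b)$, $$\lim_{N\to\infty}E_N(t)=0.$$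
   Context: The right Katugampola fractional integral of order $\alpha>0$ with parameter $\rho>0$ of an integrable function $x:[a,b]\to\mathbb{R}$, where $0\le a<b$, is $$I_{b-}^{\alpha,\rho}x(t)=\frac{\rho^{1-\alpha}}{\Gamma(\alpha)}\int_t^b \tau^{\rho-1}(\tau^\rho-t^\rho)^{\alpha-1}x(\tau)\,d\tau.$$ Here $\Gamma$ is Euler's Gamma function. Convention: for a positive integer $k$, the quotient $\Gamma(k-\alpha)/\Gamma(-\alpha)$ denotes the product $\prod_{j=0}^{k-1}(j-\alpha)$; for non-integer $\alpha$ this equals the literal quotient of Gamma values, and for integer $\alpha$ it is the limiting value of the quotient. *)

theory Defs
  imports "HOL-Analysis.Analysis"
begin

text \<open>Class \<open>C\<^sup>1\<close> on the closed interval \<open>[a,b]\<close>, with one-sided derivatives at the endpoints;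
  the values of \<open>x\<close> outside \<open>[a,b]\<close> are irrelevant.\<close>

definition C1_on_interval :: "real \<Rightarrow> real \<Rightarrow> (real \<Rightarrow> real) \<Rightarrow> bool" where
  "C1_on_interval a b x \<longleftrightarrow>
     (\<exists>x'. (\<forall>t\<in>{a..b}. (x has_real_derivative x' t) (at t within {a..b})) \<and>
           continuous_on {a..b} x')"

text \<open>In the integrals below, the convention \<open>0 powr s = 0\<close> changes the integrand at most at
  \<open>\<tau> = 0\<close> and \<open>\<tau> = t\<close>, a null set.\<close>

definition katugampola_right_integral ::
  "real \<Rightarrow> real \<Rightarrow> real \<Rightarrow> (real \<Rightarrow> real) \<Rightarrow> real \<Rightarrow> real" where
  "katugampola_right_integral \<alpha> \<rho> b x t =
     \<rho> powr (1 - \<alpha>) / Gamma \<alpha> *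
     (LINT \<tau>:{t..b}|lebesgue.
        \<tau> powr (\<rho> - 1) * (\<tau> powr \<rho> - t powr \<rho>) powr (\<alpha> - 1) * x \<tau>)"

text \<open>The quotient \<open>\<Gamma>(k-\<alpha>)/\<Gamma>(-\<alpha>)\<close>, read as a product so that it also makes sense at the
  poles, i.e. for integer \<open>\<alpha>\<close>.\<close>

definition Gamma_quot :: "real \<Rightarrow> nat \<Rightarrow> real" where
  "Gamma_quot \<alpha> k = (\<Prod>j=0..<k. real j - \<alpha>)"

lemma Gamma_quot_eq_Gamma:
  assumes "\<alpha> \<notin> \<int>"
  shows "Gamma_quot \<alpha> k = Gamma (real k - \<alpha>) / Gamma (- \<alpha>)"
proof -
  have "- \<alpha> \<notin> \<int>\<^sub>\<le>\<^sub>0"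
    using assms nonpos_Ints_Int by force
  then show ?thesis
    using pochhammer_Gamma[of "- \<alpha>" k] by (simp add: Gamma_quot_def pochhammer_prod)
qed

definition coeff_A :: "real \<Rightarrow> real \<Rightarrow> nat \<Rightarrow> real" where
  "coeff_A \<alpha> \<rho> N =
     \<rho> powr (- \<alpha>) / Gamma (\<alpha> + 1) * (1 + (\<Sum>k=1..N. Gamma_quot \<alpha> k / fact k))"

definition coeff_B :: "real \<Rightarrow> real \<Rightarrow> nat \<Rightarrow> real" where
  "coeff_B \<alpha> \<rho> k =
     \<rho> powr (1 - \<alpha>) * Gamma_quot \<alpha> k / (Gamma (\<alpha> + 1) * fact (k - 1))"

definition moment_W :: "real \<Rightarrow> real \<Rightarrow> (real \<Rightarrow> real) \<Rightarrow> nat \<Rightarrow> real \<Rightarrow> real" where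
  "moment_W \<rho> b x k t =
     (LINT \<tau>:{t..b}|lebesgue. \<tau> powr (\<rho> - 1) * (b powr \<rho> - \<tau> powr \<rho>) ^ (k - 1) * x \<tau>)"

end

theory Submission
  imports Defs
begin

text \<open>
  Integrate by parts so that the derivative falls on \<open>x\<close>. With \<open>L = b\<^sup>\<rho> - t\<^sup>\<rho>\<close> and
  \<open>u = (b\<^sup>\<rho> - \<tau>\<^sup>\<rho>) / L\<close> the fractional integral becomes a constant times
  \<open>x b - \<integral> (1 - u)\<^sup>\<alpha> x'\<close>, while integrating each moment by parts shows that the expansion of
  order \<open>N\<close> is the same expression with \<open>(1 - u)\<^sup>\<alpha>\<close> replaced by the \<open>N\<close>-th partial sum of its
  binomial series. The coefficients are absolutely summable as \<open>\<alpha> > 0\<close>, so the partial sums are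
  bounded uniformly on \<open>[t, b]\<close> and dominated convergence applies.
\<close>

section \<open>Coefficients of the binomial series of \<open>(1 - u) powr \<alpha>\<close>\<close>

lemma Gamma_quot_Suc: "Gamma_quot \<alpha> (Suc k) = Gamma_quot \<alpha> k * (real k - \<alpha>)"
  by (simp add: Gamma_quot_def)

text \<open>Reversing the sign of each factor \<open>j - \<alpha>\<close> gives the falling
  factorial of \<open>\<alpha>\<close>. No Gamma value enters, so integer \<open>\<alpha>\<close> is
  covered as well.\<close>

lemma Gamma_quot_eq_gbinomial: "Gamma_quot \<alpha> k / fact k = (-1) ^ k * (\<alpha> gchoose k)"
  by (simp add: Gamma_quot_def gbinomial_pochhammer pochhammer_prod flip: power_add mult_2)

lemma summable_abs_Gamma_quot:
  fixes \<alpha> :: real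
  assumes "\<alpha> > 0"
  shows "summable (\<lambda>k. \<bar>Gamma_quot \<alpha> k / fact k\<bar>)"
proof -
  define c where "c k = Gamma_quot \<alpha> k / fact k" for k
  have step: "(real k + 1) * c (Suc k) = (real k - \<alpha>) * c k" for k
  proof -
    have "c (Suc k) = c k * (real k - \<alpha>) / (real k + 1)"
      by (simp add: c_def Gamma_quot_Suc add.commute mult.commute)
    then show ?thesis by simp
  qed
  \<comment> \<open>By \<open>step\<close>, \<open>\<alpha> * c k = k * c k - (k + 1) * c (k + 1)\<close>; beyond \<open>\<alpha>\<close> the sign of \<open>c\<close> is constant,
    so the series of absolute values telescopes as well.\<close>
  define m where "m = nat \<lceil>\<alpha>\<rceil>"
  have m: "real k \<ge> \<alpha>" if "k \<ge> m" for k
    using that unfolding m_def by linarith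
  have abs_step: "\<alpha> * \<bar>c k\<bar> = real k * \<bar>c k\<bar> - real (Suc k) * \<bar>c (Suc k)\<bar>" if "k \<ge> m" for k
  proof -
    have "real (Suc k) * \<bar>c (Suc k)\<bar> = \<bar>(real k + 1) * c (Suc k)\<bar>"
      by (simp add: abs_mult)
    also have "\<dots> = (real k - \<alpha>) * \<bar>c k\<bar>"
      using m[OF that] by (simp add: step abs_mult)
    finally show ?thesis by (simp add: algebra_simps)
  qed
  have "\<alpha> * (\<Sum>i<n. \<bar>c (i + m)\<bar>) = real m * \<bar>c m\<bar> - real (n + m) * \<bar>c (n + m)\<bar>" for n
    by (induction n) (simp_all add: distrib_left abs_step del: of_nat_add of_nat_Suc)
  \<comment> \<open>The subtracted term \<open>real (n + m) * \<bar>c (n + m)\<bar>\<close> is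
    nonnegative, so dropping it leaves a bound free of \<open>n\<close>.\<close>
  then have "\<alpha> * (\<Sum>i<n. \<bar>c (i + m)\<bar>) \<le> real m * \<bar>c m\<bar>" for n
    by simp
  then have "(\<Sum>i<n. \<bar>c (i + m)\<bar>) \<le> real m * \<bar>c m\<bar> / \<alpha>" for n
    using assms by (simp add: field_simps)
  then have "summable (\<lambda>i. \<bar>c (i + m)\<bar>)"
    by (intro summableI_nonneg_bounded) auto
  then show ?thesis
    using summable_iff_shift[of "\<lambda>k. \<bar>c k\<bar>" m] by (simp add: c_def)
qed

lemma Gamma_quot_sums_powr:
  fixes \<alpha> u :: real
  assumes "\<bar>u\<bar> < 1"
  shows "(\<lambda>k. Gamma_quot \<alpha> k / fact k * u ^ k) sums (1 - u) powr \<alpha>"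
proof -
  have "(-1) ^ k * (\<alpha> gchoose k) * u ^ k = (\<alpha> gchoose k) * (- u) ^ k" for k
    by (simp add: power_minus[of u])
  then show ?thesis
    using gen_binomial_real[of "- u" \<alpha>] assms by (simp only: Gamma_quot_eq_gbinomial) simp
qed

section \<open>Integration by parts for the fractional integral and the moments\<close>

text \<open>\<open>G\<close> need only be differentiable in the interior, because the kernel
  \<open>(s powr \<rho> - t powr \<rho>) powr \<alpha>\<close> can have an unbounded derivative near
  \<open>t\<close> when \<open>\<alpha> < 1\<close>. The sign of \<open>g\<close> compensates: it
  makes \<open>g\<close> absolutely integrable, which allows passing from the gauge integral to the
  Lebesgue integral.\<close>

lemma lebesgue_integration_by_parts_monotone:
  fixes G g x x' :: "real \<Rightarrow> real"
  assumes "t \<le> b"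
    and "continuous_on {t..b} G"
    and "\<And>s. s \<in> {t<..<b} \<Longrightarrow> (G has_real_derivative g s) (at s)"
    and "\<And>s. s \<in> {t..b} \<Longrightarrow> 0 \<le> g s"
    and x: "\<And>s. s \<in> {t..b} \<Longrightarrow> (x has_real_derivative x' s) (at s within {t..b})"
    and "continuous_on {t..b} x'"
  shows "(LINT s:{t..b}|lebesgue. g s * x s) =
    G b * x b - G t * x t - integral {t..b} (\<lambda>s. G s * x' s)"
proof -
  have cx: "continuous_on {t..b} x"
    by (rule DERIV_continuous_on[OF x])
  have x_int: "(x has_real_derivative x' s) (at s)" if "s \<in> {t<..<b}" for s
    using x[of s] that at_within_interior[of s "{t..b}"] by auto
  have "(g has_integral G b - G t) {t..b}"
    using assms by (intro fundamental_theorem_of_calculus_interior)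
      (auto simp: has_real_derivative_iff_has_vector_derivative)
  then have "g absolutely_integrable_on {t..b}"
    using assms(4) by (intro nonnegative_absolutely_integrable_1) auto
  moreover have "bounded (x ` {t..b})"
    by (intro compact_imp_bounded compact_continuous_image cx) auto
  \<comment> \<open>A bounded measurable factor preserves absolute integrability.\<close>
  ultimately have abs_int: "(\<lambda>s. x s * g s) absolutely_integrable_on {t..b}"
    by (intro absolutely_integrable_bounded_measurable_product_real
        continuous_imp_measurable_on_sets_lebesgue cx) auto
  have "((\<lambda>s. x s * g s + G s * x' s) has_integral G b * x b - G t * x t) {t..b}"
  proof (rule fundamental_theorem_of_calculus_interior[OF assms(1)])
    show "continuous_on {t..b} (\<lambda>s. G s * x s)"
      by (intro continuous_intros assms cx)
    show "((\<lambda>s. G s * x s) has_vector_derivative x s * g s + G s * x' s) (at s)"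
      if "s \<in> {t<..<b}" for s
      unfolding has_real_derivative_iff_has_vector_derivative[symmetric]
      using assms(3)[OF that] x_int[OF that]
      by (auto intro!: derivative_eq_intros)
  qed
  moreover have "(\<lambda>s. G s * x' s) integrable_on {t..b}"
    by (intro integrable_continuous_real continuous_intros assms)
  ultimately have "((\<lambda>s. x s * g s) has_integral
      G b * x b - G t * x t - integral {t..b} (\<lambda>s. G s * x' s)) {t..b}"
    using has_integral_diff[of "\<lambda>s. x s * g s + G s * x' s" _ _ "\<lambda>s. G s * x' s"]
    by (auto dest: integrable_integral)
  then show ?thesis
    using set_lebesgue_integral_eq_integral(2)[OF abs_int] by (simp add: integral_unique mult.commute)
qed

text \<open>Continuity is needed down to \<open>s = 0\<close>, since \<open>t = 0\<close> is
  allowed.\<close>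

lemma continuous_on_powr_const_nonneg:
  fixes \<rho> :: real
  assumes "0 < \<rho>" and "S \<subseteq> {0..}"
  shows "continuous_on S (\<lambda>s. s powr \<rho>)"
  using assms by (intro continuous_on_powr') (auto intro: continuous_intros)

text \<open>Up to the factor \<open>\<alpha> * \<rho>\<close> the kernel is the derivative of
  \<open>(s powr \<rho> - t powr \<rho>) powr \<alpha>\<close>. This vanishes at \<open>t\<close>,
  so only the boundary term at \<open>b\<close> survives.\<close>

lemma katugampola_right_integral_by_parts:
  fixes x x' :: "real \<Rightarrow> real"
  assumes "0 \<le> t" and "t \<le> b" and "0 < \<alpha>" and "0 < \<rho>"
    and "\<And>s. s \<in> {t..b} \<Longrightarrow> (x has_real_derivative x' s) (at s within {t..b})"
    and "continuous_on {t..b} x'"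
  shows "katugampola_right_integral \<alpha> \<rho> b x t = \<rho> powr (- \<alpha>) / Gamma (\<alpha> + 1) *
    ((b powr \<rho> - t powr \<rho>) powr \<alpha> * x b -
      integral {t..b} (\<lambda>s. (s powr \<rho> - t powr \<rho>) powr \<alpha> * x' s))"
proof -
  let ?G = "\<lambda>s. (s powr \<rho> - t powr \<rho>) powr \<alpha>"
  let ?h = "\<lambda>s. s powr (\<rho> - 1) * (s powr \<rho> - t powr \<rho>) powr (\<alpha> - 1) * x s"
  have "(LINT s:{t..b}|lebesgue.
      (\<alpha> * \<rho> * (s powr (\<rho> - 1) * (s powr \<rho> - t powr \<rho>) powr (\<alpha> - 1))) * x s) =
    ?G b * x b - ?G t * x t - integral {t..b} (\<lambda>s. ?G s * x' s)"
  proof (rule lebesgue_integration_by_parts_monotone)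
    show "continuous_on {t..b} ?G"
      using assms
      by (intro continuous_on_powr' continuous_intros continuous_on_powr_const_nonneg)
        (auto intro: powr_mono2)
    show "(?G has_real_derivative
        \<alpha> * \<rho> * (s powr (\<rho> - 1) * (s powr \<rho> - t powr \<rho>) powr (\<alpha> - 1))) (at s)"
      if "s \<in> {t<..<b}" for s
    proof -
      have "t powr \<rho> < s powr \<rho>"
        using that assms by (intro powr_less_mono2) auto
      then show ?thesis
        using that assms by (auto intro!: derivative_eq_intros)
    qed
  qed (use assms in auto)
  moreover have "(LINT s:{t..b}|lebesgue.
      (\<alpha> * \<rho> * (s powr (\<rho> - 1) * (s powr \<rho> - t powr \<rho>) powr (\<alpha> - 1))) * x s) =
      \<alpha> * \<rho> * (LINT s:{t..b}|lebesgue. ?h s)"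
    by (simp add: mult.assoc flip: set_integral_mult_right)
  \<comment> \<open>The factor \<open>\<alpha> * \<rho>\<close> from the derivative turns
    \<open>Gamma \<alpha>\<close> into \<open>Gamma (\<alpha> + 1)\<close> and lowers the power of
    \<open>\<rho>\<close>.\<close>
  moreover have "\<rho> powr (1 - \<alpha>) / Gamma \<alpha> = \<rho> powr (- \<alpha>) / Gamma (\<alpha> + 1) * (\<alpha> * \<rho>)"
  proof -
    have "Gamma (\<alpha> + 1) = \<alpha> * Gamma \<alpha>"
      using assms(3) by (intro Gamma_plus1) auto
    moreover have "\<rho> powr (1 - \<alpha>) = \<rho> powr (- \<alpha>) * \<rho>"
      using assms(4) by (simp add: powr_diff powr_minus field_simps)
    ultimately show ?thesis using assms(3) by simp
  qed
  ultimately show ?thesis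
    by (simp add: katugampola_right_integral_def mult.assoc)
qed

lemma moment_W_by_parts:
  fixes x x' :: "real \<Rightarrow> real"
  assumes "0 \<le> t" and "t \<le> b" and "0 < \<rho>" and "1 \<le> k"
    and "\<And>s. s \<in> {t..b} \<Longrightarrow> (x has_real_derivative x' s) (at s within {t..b})"
    and "continuous_on {t..b} x'"
  shows "real k * \<rho> * moment_W \<rho> b x k t =
    (b powr \<rho> - t powr \<rho>) ^ k * x t + integral {t..b} (\<lambda>s. (b powr \<rho> - s powr \<rho>) ^ k * x' s)"
proof -
  \<comment> \<open>The minus sign makes \<open>?G\<close> increasing, so that its derivative is
    nonnegative.\<close>
  let ?G = "\<lambda>s. - ((b powr \<rho> - s powr \<rho>) ^ k)"
  have "(LINT s:{t..b}|lebesgue.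
      (real k * \<rho> * (s powr (\<rho> - 1) * (b powr \<rho> - s powr \<rho>) ^ (k - 1))) * x s) =
    ?G b * x b - ?G t * x t - integral {t..b} (\<lambda>s. ?G s * x' s)"
  proof (rule lebesgue_integration_by_parts_monotone)
    show "continuous_on {t..b} ?G"
      using assms by (intro continuous_intros continuous_on_powr_const_nonneg) auto
    show "(?G has_real_derivative
        real k * \<rho> * (s powr (\<rho> - 1) * (b powr \<rho> - s powr \<rho>) ^ (k - 1))) (at s)"
      if "s \<in> {t<..<b}" for s
      using that assms by (auto intro!: derivative_eq_intros)
    show "0 \<le> real k * \<rho> * (s powr (\<rho> - 1) * (b powr \<rho> - s powr \<rho>) ^ (k - 1))"
      if "s \<in> {t..b}" for s
      using that assms by (intro mult_nonneg_nonneg zero_le_power) (auto intro: powr_mono2)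
  qed (use assms in auto)
  moreover have "(LINT s:{t..b}|lebesgue.
      (real k * \<rho> * (s powr (\<rho> - 1) * (b powr \<rho> - s powr \<rho>) ^ (k - 1))) * x s) =
      real k * \<rho> * moment_W \<rho> b x k t"
    by (simp add: moment_W_def mult.assoc flip: set_integral_mult_right)
  \<comment> \<open>The boundary term at \<open>b\<close> is \<open>0 ^ k\<close>, which is zero
    because \<open>1 \<le> k\<close>.\<close>
  ultimately show ?thesis
    using assms(4) by (simp add: power_0_left)
qed

section \<open>The expansion of order \<open>N\<close> as a partial binomial sum\<close>

text \<open>By parts, each moment yields a multiple of \<open>x t\<close> plus an integral against
  \<open>x'\<close>. The multiples of \<open>x t\<close> cancel the sum inside
  \<open>coeff_A\<close>, and the one remaining \<open>x t\<close> is \<open>x b\<close> minus the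
  term of index 0.\<close>

lemma expansion_eq_partial_sum:
  fixes x x' :: "real \<Rightarrow> real"
  assumes "0 \<le> t" and "t < b" and "0 < \<alpha>" and "0 < \<rho>"
    and x: "\<And>s. s \<in> {t..b} \<Longrightarrow> (x has_real_derivative x' s) (at s within {t..b})"
    and cx': "continuous_on {t..b} x'"
  defines "L \<equiv> b powr \<rho> - t powr \<rho>"
  shows "coeff_A \<alpha> \<rho> N * L powr \<alpha> * x t
      - (\<Sum>k=1..N. coeff_B \<alpha> \<rho> k * L powr (\<alpha> - real k) * moment_W \<rho> b x k t) =
    \<rho> powr (- \<alpha>) / Gamma (\<alpha> + 1) * L powr \<alpha> *
      (x b - integral {t..b}
        (\<lambda>s. (\<Sum>k<Suc N. Gamma_quot \<alpha> k / fact k * ((b powr \<rho> - s powr \<rho>) / L) ^ k) * x' s))"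
proof -
  define c where "c k = Gamma_quot \<alpha> k / fact k" for k
  define K where "K = \<rho> powr (- \<alpha>) / Gamma (\<alpha> + 1)"
  define J where "J k = integral {t..b} (\<lambda>s. ((b powr \<rho> - s powr \<rho>) / L) ^ k * x' s)" for k
  have L: "L > 0"
    using assms by (auto simp: L_def intro: powr_less_mono2)
  have summand: "coeff_B \<alpha> \<rho> k * L powr (\<alpha> - real k) * moment_W \<rho> b x k t =
      K * L powr \<alpha> * (c k * (x t + J k))" if "k \<in> {1..N}" for k
  proof -
    have "(x t + J k) * L ^ k = real k * \<rho> * moment_W \<rho> b x k t"
    proof -
      have "J k * L ^ k = integral {t..b} (\<lambda>s. (b powr \<rho> - s powr \<rho>) ^ k * x' s)"
        unfolding J_def integral_mult_left[symmetric]
        using L by (intro integral_cong) (simp add: power_divide)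
      then show ?thesis
        using that assms(1-4) moment_W_by_parts[of t b \<rho> k x x', OF _ _ _ _ x cx']
        by (simp add: distrib_right mult.commute[of "x t"] flip: L_def)
    qed
    then have "x t + J k = real k * \<rho> * moment_W \<rho> b x k t / L ^ k"
      using L by (simp add: field_simps)
    moreover have "L powr (\<alpha> - real k) = L powr \<alpha> / L ^ k"
      using L by (simp add: powr_diff powr_realpow)
    moreover have "\<rho> powr (1 - \<alpha>) = \<rho> powr (- \<alpha>) * \<rho>"
      using assms(4) by (simp add: powr_diff powr_minus field_simps)
    \<comment> \<open>The factor \<open>k\<close> from integrating the moment by parts turns
      \<open>1 / fact (k - 1)\<close> in \<open>coeff_B\<close> into
      \<open>k / fact k\<close>.\<close>
    moreover have "(fact k :: real) = real k * fact (k - 1)"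
      using that by (simp add: fact_reduce)
    ultimately show ?thesis
      using that by (simp add: coeff_B_def K_def c_def mult_ac)
  qed
  have cont: "continuous_on {t..b} (\<lambda>s. c k * (((b powr \<rho> - s powr \<rho>) / L) ^ k * x' s))" for k
    using L assms by (intro continuous_intros continuous_on_powr_const_nonneg cx') auto
  \<comment> \<open>The zeroth power is 1 even at \<open>s = b\<close>, where the base is 0, so the
    integrand is just \<open>x'\<close>.\<close>
  have J0: "J 0 = x b - x t"
    using assms unfolding J_def
    by (intro integral_unique) (auto intro!: fundamental_theorem_of_calculus
        simp flip: has_real_derivative_iff_has_vector_derivative)
  have "integral {t..b} (\<lambda>s. (\<Sum>k<Suc N. c k * ((b powr \<rho> - s powr \<rho>) / L) ^ k) * x' s)
      = integral {t..b} (\<lambda>s. \<Sum>k<Suc N. c k * (((b powr \<rho> - s powr \<rho>) / L) ^ k * x' s))"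
    by (simp only: sum_distrib_right mult.assoc)
  also have "\<dots> = (\<Sum>k<Suc N.
      integral {t..b} (\<lambda>s. c k * (((b powr \<rho> - s powr \<rho>) / L) ^ k * x' s)))"
    by (intro integral_sum integrable_continuous_real cont) simp
  also have "\<dots> = (\<Sum>k<Suc N. c k * J k)"
    by (simp only: J_def integral_mult_right)
  also have "\<dots> = x b - x t + (\<Sum>k=1..N. c k * J k)"
  proof -
    have "c 0 * J 0 = x b - x t"
      by (simp add: J0 c_def Gamma_quot_def)
    then show ?thesis
      by (simp only: sum.lessThan_Suc_shift One_nat_def sum.atLeast1_atMost_eq)
  qed
  finally have integral: "integral {t..b}
      (\<lambda>s. (\<Sum>k<Suc N. c k * ((b powr \<rho> - s powr \<rho>) / L) ^ k) * x' s)
      = x b - x t + (\<Sum>k=1..N. c k * J k)" .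
  have B: "(\<Sum>k=1..N. coeff_B \<alpha> \<rho> k * L powr (\<alpha> - real k) * moment_W \<rho> b x k t) =
      K * L powr \<alpha> * ((\<Sum>k=1..N. c k) * x t + (\<Sum>k=1..N. c k * J k))"
  proof -
    have "(\<Sum>k=1..N. coeff_B \<alpha> \<rho> k * L powr (\<alpha> - real k) * moment_W \<rho> b x k t) =
        (\<Sum>k=1..N. K * L powr \<alpha> * (c k * (x t + J k)))"
      by (intro sum.cong refl summand)
    also have "\<dots> = K * L powr \<alpha> * (\<Sum>k=1..N. c k * (x t + J k))"
      by (rule sum_distrib_left[symmetric])
    finally show ?thesis
      by (simp only: distrib_left[of "c _"] sum.distrib sum_distrib_right)
  qed
  have A: "coeff_A \<alpha> \<rho> N = K * (1 + (\<Sum>k=1..N. c k))"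
    by (simp add: coeff_A_def K_def c_def)
  show ?thesis
    unfolding c_def[symmetric] K_def[symmetric] integral A B by (simp only: algebra_simps)
qed

section \<open>Passage to the limit under the integral\<close>

text \<open>The argument runs on the open interval, where \<open>0 < ?u s < 1\<close> and the
  binomial series converges; the endpoints form a null set. The constant \<open>C * M\<close>
  dominates, with \<open>C\<close> the sum of the absolute coefficients and \<open>M\<close> a bound
  for \<open>y\<close>.\<close>

lemma partial_sum_integral_tendsto:
  fixes y :: "real \<Rightarrow> real"
  assumes "0 \<le> t" and "t < b" and "0 < \<alpha>" and "0 < \<rho>" and cy: "continuous_on {t..b} y"
  defines "L \<equiv> b powr \<rho> - t powr \<rho>"
  shows "(\<lambda>N. integral {t..b}
      (\<lambda>s. (\<Sum>k<N. Gamma_quot \<alpha> k / fact k * ((b powr \<rho> - s powr \<rho>) / L) ^ k) * y s))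
    \<longlonglongrightarrow> integral {t..b} (\<lambda>s. ((s powr \<rho> - t powr \<rho>) / L) powr \<alpha> * y s)"
proof -
  let ?u = "\<lambda>s. (b powr \<rho> - s powr \<rho>) / L"
  define c where "c k = Gamma_quot \<alpha> k / fact k" for k
  define C where "C = (\<Sum>k. \<bar>c k\<bar>)"
  have summ: "summable (\<lambda>k. \<bar>c k\<bar>)"
    using summable_abs_Gamma_quot assms by (simp add: c_def)
  have L: "L > 0"
    using assms by (auto simp: L_def intro: powr_less_mono2)
  have "bounded (y ` {t..b})"
    by (intro compact_imp_bounded compact_continuous_image cy) auto
  then obtain M where M: "\<And>s. s \<in> {t..b} \<Longrightarrow> \<bar>y s\<bar> \<le> M"
    unfolding bounded_iff by (metis imageI real_norm_def)
  have u: "?u s \<in> {0<..<1}" if "s \<in> {t<..<b}" for s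
  proof -
    have "t powr \<rho> < s powr \<rho>" "s powr \<rho> < b powr \<rho>"
      using that assms by (auto intro: powr_less_mono2)
    then show ?thesis using L by (simp add: L_def)
  qed
  have bound: "\<bar>(\<Sum>k<N. c k * ?u s ^ k) * y s\<bar> \<le> C * M" if "s \<in> {t<..<b}" for N s
  proof -
    have "\<bar>\<Sum>k<N. c k * ?u s ^ k\<bar> \<le> (\<Sum>k<N. \<bar>c k * ?u s ^ k\<bar>)"
      by (rule sum_abs)
    also have "\<dots> \<le> (\<Sum>k<N. \<bar>c k\<bar>)"
    proof (rule sum_mono)
      have "\<bar>d * v ^ k\<bar> \<le> \<bar>d\<bar>" if "v \<in> {0<..<1}" for d v :: real and k
        using that by (simp add: abs_mult power_abs mult_left_le power_le_one)
      then show "\<bar>c k * ?u s ^ k\<bar> \<le> \<bar>c k\<bar>" for k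
        using u[OF that] .
    qed
    also have "\<dots> \<le> C"
      unfolding C_def by (intro sum_le_suminf summ) auto
    finally show ?thesis
      unfolding abs_mult using M[of s] that by (intro mult_mono) auto
  qed
  have lim: "(\<lambda>N. (\<Sum>k<N. c k * ?u s ^ k) * y s) \<longlonglongrightarrow> ((s powr \<rho> - t powr \<rho>) / L) powr \<alpha> * y s"
    if "s \<in> {t<..<b}" for s
  proof -
    \<comment> \<open>This identifies the sum \<open>(1 - ?u s) powr \<alpha>\<close> of the series
      with the normalised kernel.\<close>
    have "1 - ?u s = (s powr \<rho> - t powr \<rho>) / L"
      using L by (simp add: field_simps) (simp add: L_def)
    then show ?thesis
      using Gamma_quot_sums_powr[of "?u s" \<alpha>] u[OF that]
      unfolding sums_def c_def[symmetric] by (intro tendsto_mult_right) (metis abs_of_pos greaterThanLessThan_iff)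
  qed
  have int: "(\<lambda>s. (\<Sum>k<N. c k * ?u s ^ k) * y s) integrable_on {t<..<b}" for N
    unfolding integrable_on_open_interval_real
    using L assms
    by (intro integrable_continuous_real continuous_intros continuous_on_powr_const_nonneg cy) auto
  have "(\<lambda>N. integral {t<..<b} (\<lambda>s. (\<Sum>k<N. c k * ?u s ^ k) * y s))
      \<longlonglongrightarrow> integral {t<..<b} (\<lambda>s. ((s powr \<rho> - t powr \<rho>) / L) powr \<alpha> * y s)"
    by (rule dominated_convergence(2)[where h = "\<lambda>_. C * M"])
      (use int bound lim in \<open>auto simp: integrable_on_open_interval_real\<close>)
  then show ?thesis
    by (simp only: integral_open_interval_real c_def)
qed

section \<open>Vanishing of the error term\<close>

theorem theorem3p2:
  fixes a b \<alpha> \<rho> :: real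
    and x :: "real \<Rightarrow> real"
    and E :: "nat \<Rightarrow> real \<Rightarrow> real"
  assumes "0 \<le> a" and "a < b" and "\<alpha> > 0" and "\<rho> > 0"
    and "C1_on_interval a b x"
    and "\<And>N t. N \<ge> 1 \<Longrightarrow> t \<in> {a..<b} \<Longrightarrow>
      katugampola_right_integral \<alpha> \<rho> b x t =
        coeff_A \<alpha> \<rho> N * (b powr \<rho> - t powr \<rho>) powr \<alpha> * x t
        - (\<Sum>k=1..N. coeff_B \<alpha> \<rho> k * (b powr \<rho> - t powr \<rho>) powr (\<alpha> - real k) * moment_W \<rho> b x k t)
        + E N t"
  shows "\<forall>t\<in>{a..<b}. (\<lambda>N. E N t) \<longlonglongrightarrow> 0"
proof
  fix t assume t: "t \<in> {a..<b}"
  then have sub: "{t..b} \<subseteq> {a..b}" by auto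
  obtain x' where x'_ab: "\<And>s. s \<in> {a..b} \<Longrightarrow> (x has_real_derivative x' s) (at s within {a..b})"
    and cx'_ab: "continuous_on {a..b} x'"
    using assms(5) unfolding C1_on_interval_def by blast
  have x': "(x has_real_derivative x' s) (at s within {t..b})" if "s \<in> {t..b}" for s
    using x'_ab[of s] that sub by (auto intro: DERIV_subset)
  have cx': "continuous_on {t..b} x'"
    using cx'_ab sub by (rule continuous_on_subset)
  have t': "0 \<le> t" "t < b"
    using t assms by auto
  define L where "L = b powr \<rho> - t powr \<rho>"
  define K where "K = \<rho> powr (- \<alpha>) / Gamma (\<alpha> + 1)"
  \<comment> \<open>\<open>P N\<close> sums over \<open>k < N\<close>, so the expansion of order
    \<open>N\<close>, with indices 0 to \<open>N\<close>, corresponds to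
    \<open>P (Suc N)\<close>.\<close>
  define P where "P N = integral {t..b}
      (\<lambda>s. (\<Sum>k<N. Gamma_quot \<alpha> k / fact k * ((b powr \<rho> - s powr \<rho>) / L) ^ k) * x' s)" for N
  define Q where "Q = integral {t..b} (\<lambda>s. ((s powr \<rho> - t powr \<rho>) / L) powr \<alpha> * x' s)"
  have L: "L > 0"
    using t' assms by (auto simp: L_def intro: powr_less_mono2)
  have "integral {t..b} (\<lambda>s. (s powr \<rho> - t powr \<rho>) powr \<alpha> * x' s) = L powr \<alpha> * Q"
  proof -
    have "(s powr \<rho> - t powr \<rho>) powr \<alpha> * x' s =
        L powr \<alpha> * (((s powr \<rho> - t powr \<rho>) / L) powr \<alpha> * x' s)" if "s \<in> {t..b}" for s
      using that t' L assms by (subst powr_divide) (auto intro: powr_mono2)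
    then show ?thesis
      unfolding Q_def integral_mult_right[symmetric] by (intro integral_cong)
  qed
  then have I: "katugampola_right_integral \<alpha> \<rho> b x t = K * L powr \<alpha> * (x b - Q)"
    using katugampola_right_integral_by_parts[of t b \<alpha> \<rho> x x'] t' assms(3,4) x' cx'
    by (simp add: K_def right_diff_distrib mult.assoc flip: L_def)
  \<comment> \<open>The fractional integral and its expansion share the term in \<open>x b\<close>,
    so only the integrals against \<open>x'\<close> remain in their difference.\<close>
  have "E N t = K * L powr \<alpha> * (P (Suc N) - Q)" if "N \<ge> 1" for N
  proof -
    have "E N t = K * L powr \<alpha> * (x b - Q) - K * L powr \<alpha> * (x b - P (Suc N))"
      using assms(6)[OF that t] expansion_eq_partial_sum[OF t' assms(3,4) x' cx', of N] I
      unfolding K_def[symmetric] L_def[symmetric] P_def[symmetric] by linarith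
    then show ?thesis
      by (simp add: right_diff_distrib)
  qed
  \<comment> \<open>\<open>E\<close> is prescribed only for \<open>N \<ge> 1\<close>, hence the
    equality is eventual.\<close>
  then have "\<forall>\<^sub>F N in sequentially. K * L powr \<alpha> * (P (Suc N) - Q) = E N t"
    by (auto intro!: eventually_sequentiallyI[of 1])
  moreover have "P \<longlonglongrightarrow> Q"
    using partial_sum_integral_tendsto[OF t' assms(3,4) cx']
    by (simp add: P_def[abs_def] Q_def L_def)
  then have "(\<lambda>N. K * L powr \<alpha> * (P (Suc N) - Q)) \<longlonglongrightarrow> K * L powr \<alpha> * (Q - Q)"
    by (intro tendsto_intros LIMSEQ_Suc)
  ultimately show "(\<lambda>N. E N t) \<longlonglongrightarrow> 0"
    by (auto dest: Lim_transform_eventually)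
qed

end
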